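(* Let $\epsilon>0$, $\sigma\geq \frac12+\epsilon$, $l\in\mathbb{N}$ be fixed, and put $A=\sqrt[3]{(1-c)\,\bar{c}(l)\,\zeta(2\sigma)}$. For $x,y,z,n\in\mathbb{N}$ with $n\geq 3$ let $r=\frac{x^n+y^n}{z^n}$, $T(\tau)=\frac{r\tau}{A}$ and \[ L(x,y,z,n)=\lim_{\tau\to\infty}\frac{1}{\tau}\left\{\int_{T(\tau)}^{\varphi_1^{-1}(T(\tau))}\left|\zeta\left(\tfrac12+it\right)\right|^2{\rm d}t\times\int_1^{T(\tau)}|\zeta(\sigma+it)|^2{\rm d}t\times\int_1^{T(\tau)}|S_1(t)|^{2l}{\rm d}t\right\}^{1/3}. \] Then the following are equivalent: (i) (Fermat–Wiles theorem) there are no $x,y,z,n\in\mathbb{N}$ with $n\geq3$ and $x^n+y^n=z^n$; (ii) $L(x,y,z,n)\neq 1$ for all $x,y,z,n\in\mathbb{N}$ with $n\geq 3$.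
   Context: $\zeta$ is the Riemann zeta-function and $c$ is Euler's constant. $S(t)=\frac1\pi\arg\zeta(\frac12+it)$ (argument defined by continuous variation in the usual way) and $S_1(t)=\int_0^t S(u)\,{\rm d}u$. For $l\in\mathbb{N}$, $\bar{c}(l)>0$ is the constant in Selberg's formula $\int_1^T|S_1(t)|^{2l}{\rm d}t=\bar{c}(l)T+O(T/\ln T)$ as $T\to\infty$. $\varphi_1$ denotes a Jacob's ladder (in the sense of Moser): an increasing function whose inverse $\varphi_1^{-1}(T)$ is defined for all sufficiently large $T$, satisfies $T<\varphi_1^{-1}(T)$, and for every fixed small $\delta>0$ satisfies $\int_T^{\varphi_1^{-1}(T)}|\zeta(\frac12+it)|^2{\rm d}t=(1-c)T+O(T^{1/3+\delta})$ as $T\to\infty$. *)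

theory Defs
  imports "HOL-Complex_Analysis.Complex_Analysis" "HOL-Library.Landau_Symbols"
begin

text \<open>
  The Riemann zeta-function is the holomorphic function on the plane without 1 that continues
  its Dirichlet series.  The lemmas up to \<^verbatim>\<open>zeta_continuation_exists\<close> prove that the
  continuation exists: expanding \<^verbatim>\<open>(m + 1) powr (1 - s)\<close> by Taylor at \<^verbatim>\<open>m\<close> and summing over
  \<^verbatim>\<open>m\<close> expresses \<^verbatim>\<open>(s - 1) * zeta s\<close> through its values at \<^verbatim>\<open>s + 1, s + 2, ...\<close>.
\<close>

definition falling :: "nat \<Rightarrow> complex \<Rightarrow> complex" where
  "falling k s = (\<Prod>i<k. 1 - s - of_nat i)"

definition zdiff :: "nat \<Rightarrow> nat \<Rightarrow> complex \<Rightarrow> complex" where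
  "zdiff K n s = (\<Sum>k\<le>K. falling k s / fact k * of_nat (Suc n) powr (1 - s - of_nat k))
                 - of_nat (Suc (Suc n)) powr (1 - s)"

lemma falling_holo: "falling k holomorphic_on A"
  unfolding falling_def by (intro holomorphic_intros)

lemma zdiff_bound:
  assumes "Re s > 1 - real K"
  shows "cmod (zdiff K n s) \<le> cmod (falling (Suc K) s) * real (Suc n) powr (- Re s - real K)"
proof -
  define w z where "w = complex_of_real (real (Suc n))" and "z = complex_of_real (real (Suc (Suc n)))"
  define f where "f = (\<lambda>i x. falling i s * x powr (1 - s - of_nat i))"
  have zw: "z - w = 1" by (simp add: z_def w_def)
  define B where "B = cmod (falling (Suc K) s) * real (Suc n) powr (- Re s - real K)"
  have seg: "\<exists>u. x = of_real u \<and> real (Suc n) \<le> u" if x: "x \<in> closed_segment w z" for x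
  proof -
    obtain t where "x = (1 - t) *\<^sub>R w + t *\<^sub>R z" "0 \<le> t" "t \<le> 1"
      using x unfolding closed_segment_def by blast
    then have "x = of_real (real (Suc n) + t)" "real (Suc n) \<le> real (Suc n) + t"
      by (auto simp: w_def z_def scaleR_conv_of_real algebra_simps)
    then show ?thesis by blast
  qed
  have "cmod (f 0 z - (\<Sum>i\<le>K. f i w * (z - w) ^ i / fact i)) \<le> B * cmod (z - w) ^ Suc K / fact K"
  proof (rule complex_Taylor[where S = "closed_segment w z"])
    fix i x assume x: "x \<in> closed_segment w z"
    obtain u where u: "x = of_real u" "real (Suc n) \<le> u" using seg[OF x] by blast
    then have "x \<notin> \<real>\<^sub>\<le>\<^sub>0" by (auto simp: complex_nonpos_Reals_iff)
    then show "(f i has_field_derivative f (Suc i) x) (at x within closed_segment w z)"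
      unfolding f_def falling_def
      by (auto intro!: derivative_eq_intros simp: algebra_simps)
  next
    fix x assume x: "x \<in> closed_segment w z"
    obtain u where u: "x = of_real u" "real (Suc n) \<le> u" using seg[OF x] by blast
    have "cmod (x powr (1 - s - of_nat (Suc K))) = u powr (- Re s - real K)"
      using u by (simp add: norm_powr_real_powr)
    also have "\<dots> \<le> real (Suc n) powr (- Re s - real K)"
      using u assms by (intro powr_mono2') auto
    finally show "cmod (f (Suc K) x) \<le> B"
      unfolding f_def B_def norm_mult by (intro mult_left_mono) auto
  qed auto
  moreover have "f 0 z - (\<Sum>i\<le>K. f i w * (z - w) ^ i / fact i) = - zdiff K n s"
    unfolding zw by (simp add: f_def zdiff_def falling_def w_def z_def)
  ultimately have "cmod (zdiff K n s) \<le> B / fact K" by (simp add: zw)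
  also have "\<dots> \<le> B"
  proof -
    have "0 \<le> B" by (simp add: B_def)
    then show ?thesis using divide_left_mono[of 1 "fact K" B] by (simp add: fact_ge_1)
  qed
  finally show ?thesis by (simp add: B_def)
qed

lemma summable_Suc_powr: "p > 1 \<Longrightarrow> summable (\<lambda>n. real (Suc n) powr (- p))"
  by (subst summable_Suc_iff) (simp add: summable_real_powr_iff)

lemma zdiff_sums_holo:
  obtains D where "D holomorphic_on {s. Re s > 1 - real K}"
    "\<And>s. Re s > 1 - real K \<Longrightarrow> (\<lambda>n. zdiff K n s) sums D s"
proof -
  define S where "S = {s::complex. Re s > 1 - real K}"
  have op: "open S" unfolding S_def by (rule open_halfspace_Re_gt)
  have "\<exists>g. \<forall>x \<in> S. ((\<lambda>n. zdiff K n x) sums g x) \<and> g field_differentiable (at x)"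
  proof (rule series_differentiable_comparison_complex[OF op, of "zdiff K"])
    fix n x assume "x \<in> S"
    have "zdiff K n holomorphic_on UNIV"
      unfolding zdiff_def falling_def by (intro holomorphic_intros) auto
    then show "zdiff K n field_differentiable at x"
      by (simp add: holomorphic_on_def)
  next
    fix x assume x: "x \<in> S"
    define d where "d = (Re x + K - 1) / 2"
    define p where "p = (Re x + K + 1) / 2"
    have d: "d > 0" and p: "p > 1" using x by (auto simp: d_def p_def S_def)
    have "compact (falling (Suc K) ` cball x d)"
      by (intro compact_continuous_image holomorphic_on_imp_continuous_on falling_holo) auto
    then obtain M where M: "\<And>y. y \<in> cball x d \<Longrightarrow> cmod (falling (Suc K) y) \<le> M"
      by (meson bounded_iff compact_imp_bounded imageI)
    have M0: "M \<ge> 0" using order_trans[OF norm_ge_zero M[of x]] d by simp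
    define h where "h = (\<lambda>n. complex_of_real (M * real (Suc n) powr (- p)))"
    have "cmod (zdiff K n y) \<le> cmod (h n)" if y: "y \<in> ball x d \<inter> S" for n y
    proof -
      have "\<bar>Re (x - y)\<bar> \<le> cmod (x - y)" by (rule abs_Re_le_cmod)
      with y have "Re y > Re x - d" by (auto simp: dist_norm)
      then have py: "- Re y - real K \<le> - p" by (auto simp: d_def p_def field_simps)
      have "cmod (zdiff K n y) \<le> cmod (falling (Suc K) y) * real (Suc n) powr (- Re y - real K)"
        using y by (intro zdiff_bound) (auto simp: S_def)
      also have "\<dots> \<le> M * real (Suc n) powr (- p)"
        using M[of y] y py M0 by (intro mult_mono powr_mono) auto
      finally show ?thesis using M0 by (simp add: h_def norm_mult)
    qed
    moreover have "summable h" unfolding h_def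
      by (intro summable_of_real summable_mult summable_Suc_powr p)
    moreover have "range h \<subseteq> \<real>\<^sub>\<ge>\<^sub>0" using M0 by (auto simp: h_def)
    ultimately show "\<exists>d h. 0 < d \<and> summable h \<and> range h \<subseteq> \<real>\<^sub>\<ge>\<^sub>0 \<and>
        (\<forall>\<^sub>F n in sequentially. \<forall>y\<in>ball x d \<inter> S. cmod (zdiff K n y) \<le> cmod (h n))"
      using d by (intro exI[of _ d] exI[of _ h]) auto
  qed blast
  then obtain g where "\<forall>x \<in> S. ((\<lambda>n. zdiff K n x) sums g x) \<and> g field_differentiable (at x)" by blast
  then show ?thesis
    by (intro that[of g])
       (auto simp: S_def holomorphic_on_def intro: field_differentiable_at_within)
qed

definition dseries :: "complex \<Rightarrow> complex" where
  "dseries s = (\<Sum>n. 1 / of_nat (Suc n) powr s)"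

lemma dseries_sums:
  assumes "Re s > 1" shows "(\<lambda>n. 1 / of_nat (Suc n) powr s) sums dseries s"
  unfolding dseries_def
proof (rule summable_sums, rule summable_norm_cancel)
  have "norm (1 / of_nat (Suc n) powr s) = real (Suc n) powr (- Re s)" for n
    using norm_powr_real_powr[of "of_nat (Suc n)" s]
    by (simp add: norm_divide powr_minus divide_simps del: of_nat_Suc)
  then show "summable (\<lambda>n. norm (1 / of_nat (Suc n) powr s))"
    using summable_Suc_powr[OF assms] by simp
qed

lemma zdiff_sums:
  assumes "Re s > 1"
  shows "(\<lambda>n. zdiff K n s) sums
     (1 + (\<Sum>k\<in>{1..K}. falling k s / fact k * dseries (s + of_nat k - 1)))"
proof -
  have "(\<lambda>n. of_nat (Suc n) powr (1 - s)) \<longlonglongrightarrow> (0::complex)"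
  proof (rule tendsto_norm_zero_cancel)
    have "((\<lambda>n. real (Suc n) powr (1 - Re s)) \<longlongrightarrow> 0) sequentially"
      using assms by (intro tendsto_neg_powr filterlim_compose[OF filterlim_real_sequentially filterlim_Suc]) auto
    moreover have "norm (of_nat (Suc n) powr (1 - s)) = real (Suc n) powr (1 - Re s)" for n
      using norm_powr_real_powr[of "of_nat (Suc n)" "1 - s"] by (simp del: of_nat_Suc)
    ultimately show "(\<lambda>n. norm (of_nat (Suc n) powr (1 - s) :: complex)) \<longlonglongrightarrow> 0" by simp
  qed
  from telescope_sums'[OF this]
  have 1: "(\<lambda>n. of_nat (Suc n) powr (1 - s) - of_nat (Suc (Suc n)) powr (1 - s)) sums (1::complex)"
    by simp
  have 2: "(\<lambda>n. falling k s / fact k * of_nat (Suc n) powr (1 - s - of_nat k))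
       sums (falling k s / fact k * dseries (s + of_nat k - 1))" if "k \<in> {1..K}" for k
  proof (rule sums_mult)
    have "(\<lambda>n. 1 / of_nat (Suc n) powr (s + of_nat k - 1)) sums dseries (s + of_nat k - 1)"
      using assms that by (intro dseries_sums) auto
    moreover have "1 / of_nat (Suc n) powr (s + of_nat k - 1) = (of_nat (Suc n) powr (1 - s - of_nat k) :: complex)" for n
      using powr_minus[of "of_nat (Suc n) :: complex" "s + of_nat k - 1"]
      by (simp add: inverse_eq_divide algebra_simps del: of_nat_Suc)
    ultimately show "(\<lambda>n. of_nat (Suc n) powr (1 - s - of_nat k)) sums dseries (s + of_nat k - 1)" by simp
  qed
  have eq: "zdiff K n s = (of_nat (Suc n) powr (1 - s) - of_nat (Suc (Suc n)) powr (1 - s)) +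
     (\<Sum>k\<in>{1..K}. falling k s / fact k * of_nat (Suc n) powr (1 - s - of_nat k))" for n
  proof -
    have "{..K} = insert 0 {1..K}" by auto
    then show ?thesis unfolding zdiff_def by (simp add: falling_def)
  qed
  show ?thesis unfolding eq by (intro sums_add 1 sums_sum 2)
qed

lemma continuation_halfplane:
  "\<exists>Z. Z holomorphic_on {s. Re s > - real N} \<and> (\<forall>s. Re s > 1 \<longrightarrow> Z s = (s - 1) * dseries s)"
proof (induction N rule: less_induct)
  case (less N)
  obtain D where D: "D holomorphic_on {s. Re s > 1 - real (Suc N)}"
    "\<And>s. Re s > 1 - real (Suc N) \<Longrightarrow> (\<lambda>n. zdiff (Suc N) n s) sums D s"
    using zdiff_sums_holo by blast
  obtain Y where Y: "N > 0 \<Longrightarrow> Y holomorphic_on {s. Re s > - real (N - 1)}"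
     "N > 0 \<Longrightarrow> (\<forall>s. Re s > 1 \<longrightarrow> Y s = (s - 1) * dseries s)"
    using less.IH[of "N - 1"] by (cases "N > 0") auto
  define Z where "Z = (\<lambda>s. 1 - D s - (\<Sum>k\<in>{2..Suc N}. falling (k-1) s / fact k * Y (s + of_nat k - 1)))"
  have "Z holomorphic_on {s. Re s > - real N}"
    unfolding Z_def
  proof (intro holomorphic_on_diff holomorphic_on_sum holomorphic_on_mult holomorphic_on_const)
    show "D holomorphic_on {s. Re s > - real N}" using D(1) by simp
    fix k assume k: "k \<in> {2..Suc N}"
    then have "(Y \<circ> (\<lambda>s. s + of_nat k - 1)) holomorphic_on {s. Re s > - real N}"
      by (intro holomorphic_on_compose_gen[OF _ Y(1)] holomorphic_intros) auto
    then show "(\<lambda>s. Y (s + of_nat k - 1)) holomorphic_on {s. Re s > - real N}"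
      by (simp add: o_def)
    show "(\<lambda>s. falling (k-1) s / fact k) holomorphic_on {s. Re s > - real N}"
      unfolding falling_def by (intro holomorphic_intros) auto
  qed
  moreover have "Z s = (s - 1) * dseries s" if s: "Re s > 1" for s
  proof -
    have "D s = 1 + (\<Sum>k\<in>{1..Suc N}. falling k s / fact k * dseries (s + of_nat k - 1))"
      using D(2)[of s] zdiff_sums[OF s, of "Suc N"] s sums_unique2 by auto
    also have "{1..Suc N} = insert 1 {2..Suc N}" by auto
    also have "(\<Sum>k\<in>insert 1 {2..Suc N}. falling k s / fact k * dseries (s + of_nat k - 1))
       = (1 - s) * dseries s + (\<Sum>k\<in>{2..Suc N}. falling k s / fact k * dseries (s + of_nat k - 1))"
      by (subst sum.insert) (auto simp: falling_def)
    also have "(\<Sum>k\<in>{2..Suc N}. falling k s / fact k * dseries (s + of_nat k - 1))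
       = (\<Sum>k\<in>{2..Suc N}. - (falling (k-1) s / fact k * Y (s + of_nat k - 1)))"
    proof (rule sum.cong[OF refl])
      fix k assume k: "k \<in> {2..Suc N}"
      then obtain j where j: "k = Suc j" by (cases k) auto
      have "Y (s + of_nat k - 1) = (s + of_nat k - 1 - 1) * dseries (s + of_nat k - 1)"
        using Y(2) k s by auto
      moreover have "falling k s = - (falling (k-1) s * (s + of_nat k - 1 - 1))"
        by (simp add: j falling_def algebra_simps)
      ultimately show "falling k s / fact k * dseries (s + of_nat k - 1) = - (falling (k-1) s / fact k * Y (s + of_nat k - 1))"
        by simp
    qed
    finally show ?thesis by (simp add: Z_def sum_negf algebra_simps)
  qed
  ultimately show ?case by blast
qed

lemma zeta_continuation_exists:
  "\<exists>f. f holomorphic_on (- {1}) \<and> (\<forall>s. Re s > 1 \<longrightarrow> (\<lambda>n. 1 / of_nat (Suc n) powr s) sums f s)"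
proof -
  obtain Z where Z: "\<And>N. Z N holomorphic_on {s. Re s > - real N}"
      "\<And>N s. Re s > 1 \<Longrightarrow> Z N s = (s - 1) * dseries s"
    using continuation_halfplane by metis
  have agree: "Z M s = Z N s" if "M \<le> N" "Re s > - real M" for M N s
  proof (rule analytic_continuation_open[of "{s. Re s > 1}" "{s. Re s > - real M}" "Z M" "Z N"])
    show "{s. 1 < Re s} \<noteq> {}" by (auto intro!: exI[of _ 2])
    show "connected {s. - real M < Re s}"
      by (intro convex_connected convex_halfspace_Re_gt)
    show "Z N holomorphic_on {s. - real M < Re s}"
      by (rule holomorphic_on_subset[OF Z(1)]) (use that in auto)
  qed (use that Z in \<open>auto simp: open_halfspace_Re_gt\<close>)
  define F where "F = (\<lambda>s. Z (nat \<lceil>\<bar>Re s\<bar>\<rceil> + 1) s)"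
  have FZ: "F s = Z N s" if "Re s > - real N" for s N
  proof -
    define M where "M = nat \<lceil>\<bar>Re s\<bar>\<rceil> + 1"
    have "Re s > - real M" unfolding M_def by linarith
    then have "Z M s = Z N s"
      using that agree[of M N s] agree[of N M s, symmetric] le_cases[of M N] by blast
    then show ?thesis by (simp add: F_def M_def)
  qed
  have "F holomorphic_on UNIV"
  proof (rule holomorphic_onI)
    fix s
    obtain N where N: "real N > - Re s" using reals_Archimedean2 by blast
    have "F holomorphic_on {s. Re s > - real N}"
      using Z(1)[of N] by (rule holomorphic_transform) (auto simp: FZ)
    then have "F field_differentiable at s"
      using N by (auto intro!: holomorphic_on_imp_differentiable_at simp: open_halfspace_Re_gt)
    then show "F field_differentiable at s within UNIV" by simp
  qed
  then have "(\<lambda>s. F s / (s - 1)) holomorphic_on (- {1})"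
    by (intro holomorphic_intros) (auto intro: holomorphic_on_subset)
  moreover have "(\<lambda>n. 1 / of_nat (Suc n) powr s) sums (F s / (s - 1))" if s: "Re s > 1" for s
  proof -
    have "F s / (s - 1) = dseries s" using FZ[of 0 s] Z(2)[of s 0] s by auto
    then show ?thesis using dseries_sums[OF s] by simp
  qed
  ultimately show ?thesis by (intro exI[of _ "\<lambda>s. F s / (s - 1)"]) auto
qed

definition zeta :: "complex \<Rightarrow> complex" where
  "zeta = (SOME f. f holomorphic_on (- {1}) \<and>
             (\<forall>s. Re s > 1 \<longrightarrow> (\<lambda>n. 1 / of_nat (Suc n) powr s) sums f s))"

lemma zeta_holomorphic: "zeta holomorphic_on (- {1})"
  and zeta_sums: "Re s > 1 \<Longrightarrow> (\<lambda>n. 1 / of_nat (Suc n) powr s) sums zeta s"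
  using someI_ex[OF zeta_continuation_exists] unfolding zeta_def by blast+

lemma zeta_unique:
  assumes f: "f holomorphic_on (- {1})"
    and sums: "\<And>s. Re s > 1 \<Longrightarrow> (\<lambda>n. 1 / of_nat (Suc n) powr s) sums f s"
    and "s \<noteq> 1"
  shows "f s = zeta s"
proof (rule analytic_continuation_open[of "{s. Re s > 1}" "- {1}" f zeta])
  show "{s. 1 < Re s} \<noteq> {}" by (auto intro!: exI[of _ 2])
  show "connected (- {1 :: complex})"
    by (rule connected_punctured_universe) simp
qed (use assms zeta_holomorphic sums_unique2[OF sums zeta_sums] in
     \<open>auto simp: open_halfspace_Re_gt\<close>)

text \<open>
  The argument of \<^verbatim>\<open>zeta (1/2 + i t)\<close>, by continuous variation along the straight segments from
  \<^verbatim>\<open>2\<close> to \<^verbatim>\<open>2 + i t\<close> to \<^verbatim>\<open>1/2 + i t\<close>, starting from argument 0 of \<^verbatim>\<open>zeta 2 > 0\<close>.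
\<close>

definition zeta_arg_path :: "real \<Rightarrow> real \<Rightarrow> complex" where
  "zeta_arg_path t = linepath 2 (Complex 2 t) +++ linepath (Complex 2 t) (Complex (1/2) t)"

definition zeta_arg :: "real \<Rightarrow> real" where
  "zeta_arg t = (THE \<theta>. \<exists>\<phi>. continuous_on {0..1} \<phi> \<and> \<phi> 0 = 0 \<and> \<phi> 1 = \<theta> \<and>
      (\<forall>u\<in>{0..1}. zeta (zeta_arg_path t u) =
         complex_of_real (cmod (zeta (zeta_arg_path t u))) * cis (\<phi> u)))"

text \<open>
  At the exceptional heights, where the path meets a zero or the pole of zeta, the value of
  \<^verbatim>\<open>zeta_S\<close> is its limit from the right.
\<close>

definition zeta_S :: "real \<Rightarrow> real" where
  "zeta_S t = (if t = 0 \<or> (\<exists>\<sigma>\<in>{1/2..2}. zeta (Complex \<sigma> t) = 0)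
          then Lim (at_right t) (\<lambda>u. zeta_arg u / pi) else zeta_arg t / pi)"

definition zeta_S1 :: "real \<Rightarrow> real" where
  "zeta_S1 t = integral {0..t} zeta_S"

definition selberg_constant :: "nat \<Rightarrow> real \<Rightarrow> bool" where
  "selberg_constant l cbar \<longleftrightarrow> cbar > 0 \<and>
     (\<lambda>T. integral {1..T} (\<lambda>t. \<bar>zeta_S1 t\<bar> ^ (2 * l)) - cbar * T) \<in> O(\<lambda>T. T / ln T)"

text \<open>
  A ladder lives on a half-line \<^verbatim>\<open>{t0..}\<close>; its inverse is taken relative to that domain.
\<close>

abbreviation ladder_inv :: "real \<Rightarrow> (real \<Rightarrow> real) \<Rightarrow> real \<Rightarrow> real" where
  "ladder_inv t0 \<phi> \<equiv> inv_into {t0..} \<phi>"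

definition jacobs_ladder :: "real \<Rightarrow> (real \<Rightarrow> real) \<Rightarrow> bool" where
  "jacobs_ladder t0 \<phi> \<longleftrightarrow>
     strict_mono_on {t0..} \<phi> \<and>
     (\<forall>\<^sub>F T in at_top. T \<in> \<phi> ` {t0..} \<and> T < ladder_inv t0 \<phi> T) \<and>
     (\<forall>\<delta>>0. (\<lambda>T. integral {T..ladder_inv t0 \<phi> T} (\<lambda>t. (cmod (zeta (Complex (1/2) t)))\<^sup>2)
               - (1 - euler_mascheroni) * T) \<in> O(\<lambda>T. T powr (1/3 + \<delta>)))"

definition scale_A :: "real \<Rightarrow> nat \<Rightarrow> real \<Rightarrow> real" where
  "scale_A \<sigma> l cbar = root 3 ((1 - euler_mascheroni) * cbar * Re (zeta (of_real (2 * \<sigma>))))"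

definition fermat_ratio :: "nat \<Rightarrow> nat \<Rightarrow> nat \<Rightarrow> nat \<Rightarrow> real" where
  "fermat_ratio x y z n = (real x ^ n + real y ^ n) / real z ^ n"

definition fermat_L ::
  "real \<Rightarrow> (real \<Rightarrow> real) \<Rightarrow> real \<Rightarrow> nat \<Rightarrow> real \<Rightarrow> nat \<Rightarrow> nat \<Rightarrow> nat \<Rightarrow> nat \<Rightarrow> real" where
  "fermat_L t0 \<phi> \<sigma> l cbar x y z n =
     Lim at_top (\<lambda>\<tau>. let T = fermat_ratio x y z n * \<tau> / scale_A \<sigma> l cbar in
       1 / \<tau> * root 3
         (integral {T..ladder_inv t0 \<phi> T} (\<lambda>t. (cmod (zeta (Complex (1/2) t)))\<^sup>2) *
          integral {1..T} (\<lambda>t. (cmod (zeta (Complex \<sigma> t)))\<^sup>2) *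
          integral {1..T} (\<lambda>t. \<bar>zeta_S1 t\<bar> ^ (2 * l))))"

end

theory Submission
  imports Defs "HOL-Real_Asymp.Real_Asymp"
begin

text \<open>
  The limit exists and equals \<^verbatim>\<open>r = (x^n + y^n) / z^n\<close>: by the defining properties of the ladder
  and of Selberg's constant the first and third integrals are asymptotic to \<^verbatim>\<open>(1 - c) T\<close> and
  \<^verbatim>\<open>cbar T\<close>, and the second one is asymptotic to \<^verbatim>\<open>zeta (2 sigma) T\<close>, so the cube root is
  asymptotic to \<^verbatim>\<open>A T = r tau\<close>.

  For the mean square of zeta to the right of the critical line, split off the first \<^verbatim>\<open>N\<close> terms
  of the Dirichlet series, where \<^verbatim>\<open>N\<close> is about \<^verbatim>\<open>T powr q\<close> with \<^verbatim>\<open>q > 1\<close> close to 1.  The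
  off-diagonal terms of the Dirichlet polynomial contribute \<^verbatim>\<open>O(N powr (2 - 2 sigma) (ln N)^2)\<close>,
  which is \<^verbatim>\<open>o(T)\<close> for \<^verbatim>\<open>q < 1 / (2 - 2 sigma)\<close>.  The tail is \<^verbatim>\<open>O(N powr (1 - sigma) / t)\<close>:
  since \<^verbatim>\<open>t / N\<close> is at most a negative power of \<^verbatim>\<open>T\<close>, a Taylor expansion of sufficiently high
  order suffices, and no estimate of exponential sums is needed.
\<close>

section \<open>Analytically continued tails of the Dirichlet series\<close>

text \<open>\<open>zdiff_sums\<close> extends to the left by the identity theorem. Staying in the
  upper half-plane keeps every argument \<open>s + of_nat k - 1\<close> away from the pole at 1 and
  keeps the domain convex, hence connected.\<close>

lemma zdiff_sums_zeta:
  assumes "Re s > 1 - real K" and "Im s > 0"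
  shows "(\<lambda>n. zdiff K n s) sums
     (1 + (\<Sum>k\<in>{1..K}. falling k s / fact k * zeta (s + of_nat k - 1)))"
proof -
  obtain D where D: "D holomorphic_on {s. Re s > 1 - real K}"
    "\<And>s. Re s > 1 - real K \<Longrightarrow> (\<lambda>n. zdiff K n s) sums D s"
    using zdiff_sums_holo by blast
  define U where "U = {s. Re s > 1 - real K} \<inter> {s. Im s > 0}"
  define f where "f = (\<lambda>s. 1 + (\<Sum>k\<in>{1..K}. falling k s / fact k * zeta (s + of_nat k - 1)))"
  have "f holomorphic_on U" unfolding f_def
  proof (intro holomorphic_intros)
    fix k
    have "(zeta \<circ> (\<lambda>s. s + of_nat k - 1)) holomorphic_on U"
      by (intro holomorphic_on_compose_gen[OF _ zeta_holomorphic] holomorphic_intros)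
         (auto simp: U_def complex_eq_iff)
    then show "(\<lambda>s. zeta (s + of_nat k - 1)) holomorphic_on U" by (simp add: o_def)
  qed (auto simp: falling_holo)
  moreover have "D holomorphic_on U"
    using D(1) by (rule holomorphic_on_subset) (auto simp: U_def)
  moreover have "D z = f z" if z: "Re z > 1" for z
  proof -
    have "zeta w = dseries w" if "Re w > 1" for w
      using that zeta_sums dseries_sums sums_unique2 by blast
    then have "f z = 1 + (\<Sum>k\<in>{1..K}. falling k z / fact k * dseries (z + of_nat k - 1))"
      unfolding f_def using z by (intro arg_cong2[where f = "(+)"] sum.cong) auto
    then show ?thesis
      using D(2)[of z] zdiff_sums[OF z, of K] z sums_unique2 by auto
  qed
  ultimately have hD: "D holomorphic_on U" and hf: "f holomorphic_on U" and eq: "\<And>z. Re z > 1 \<Longrightarrow> D z = f z"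
    by auto
  have "D s = f s"
  proof (rule analytic_continuation_open[of "{s. Re s > 1} \<inter> {s. Im s > 0}" U D f])
    show "{s. 1 < Re s} \<inter> {s. 0 < Im s} \<noteq> {}"
      by (rule ex_in_conv[THEN iffD1], rule exI[of _ "Complex 2 1"]) simp
    show "connected U" unfolding U_def
      by (intro convex_connected convex_Int convex_halfspace_Re_gt convex_halfspace_Im_gt)
    show "open U" unfolding U_def
      by (intro open_Int open_halfspace_Re_gt open_halfspace_Im_gt)
    show "{s. 1 < Re s} \<inter> {s. 0 < Im s} \<subseteq> U" by (auto simp: U_def)
    show "s \<in> U" using assms by (simp add: U_def)
  qed (use hD hf eq in \<open>auto intro!: open_Int open_halfspace_Re_gt open_halfspace_Im_gt\<close>)
  then show ?thesis using D(2)[of s] assms by (simp add: f_def)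
qed

text \<open>For \<open>Re s > 1\<close> this is the sum of the omitted terms. Further left the
  series diverges, and the partial sum is compared with the continued function instead.\<close>

definition zeta_tail :: "nat \<Rightarrow> complex \<Rightarrow> complex" where
  "zeta_tail N s = zeta s - (\<Sum>n<N. 1 / of_nat (Suc n) powr s)"

text \<open>Subtract the first \<open>N\<close> terms from \<open>zdiff_sums_zeta\<close>. The
  \<open>k = 0\<close> part telescopes and leaves only the boundary power of \<open>Suc N\<close>;
  for \<open>k >= 1\<close> the partial sums turn zeta values into tails.\<close>

lemma zdiff_tail_sums:
  assumes "Re s > 1 - real K" and "Im s > 0"
  shows "(\<lambda>n. zdiff K (n + N) s) sums
     (of_nat (Suc N) powr (1 - s) +
      (\<Sum>k\<in>{1..K}. falling k s / fact k * zeta_tail N (s + of_nat k - 1)))"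
proof -
  have powr_eq: "of_nat (Suc n) powr (1 - s - of_nat k) = (1 / of_nat (Suc n) powr (s + of_nat k - 1) :: complex)" for n k
    using powr_minus[of "of_nat (Suc n) :: complex" "s + of_nat k - 1"]
    by (simp add: inverse_eq_divide algebra_simps del: of_nat_Suc)
  have eq: "zdiff K n s = (of_nat (Suc n) powr (1 - s) - of_nat (Suc (Suc n)) powr (1 - s)) +
     (\<Sum>k\<in>{1..K}. falling k s / fact k * (1 / of_nat (Suc n) powr (s + of_nat k - 1)))" for n
  proof -
    have "{..K} = insert 0 {1..K}" by auto
    then show ?thesis unfolding zdiff_def powr_eq[symmetric] by (simp add: falling_def)
  qed
  have tel: "(\<Sum>n<N. of_nat (Suc n) powr (1 - s) - of_nat (Suc (Suc n)) powr (1 - s)) = 1 - (of_nat (Suc N) powr (1 - s) :: complex)"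
    using sum_lessThan_telescope'[of "\<lambda>n. of_nat (Suc n) powr (1 - s) :: complex" N] by simp
  have "(\<Sum>n<N. zdiff K n s) = 1 - of_nat (Suc N) powr (1 - s) +
     (\<Sum>k\<in>{1..K}. falling k s / fact k * (\<Sum>n<N. 1 / of_nat (Suc n) powr (s + of_nat k - 1)))"
    unfolding eq sum.distrib tel by (subst sum.swap) (simp add: sum_distrib_left)
  then have "1 + (\<Sum>k\<in>{1..K}. falling k s / fact k * zeta (s + of_nat k - 1)) - (\<Sum>n<N. zdiff K n s) =
     of_nat (Suc N) powr (1 - s) +
      (\<Sum>k\<in>{1..K}. falling k s / fact k * zeta_tail N (s + of_nat k - 1))"
    by (simp only: zeta_tail_def right_diff_distrib sum_subtractf) (simp add: algebra_simps)
  then show ?thesis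
    using sums_split_initial_segment[OF zdiff_sums_zeta[OF assms], of N] by simp
qed

text \<open>Mean value theorem for the power \<open>1 - a\<close>, with the derivative estimated at
  the right endpoint: one step of the integral comparison.\<close>

lemma powr_diff_ge:
  fixes a x :: real
  assumes "a > 1" "x > 0"
  shows "(a - 1) * (x + 1) powr (- a) \<le> x powr (1 - a) - (x + 1) powr (1 - a)"
proof -
  have "\<exists>z>x. z < x + 1 \<and> (x + 1) powr (1 - a) - x powr (1 - a) = (x + 1 - x) * ((1 - a) * z powr (- a))"
    using assms has_real_derivative_powr[of _ "1 - a"] by (intro MVT2) auto
  then obtain z where z: "x < z" "z < x + 1"
     "(x + 1) powr (1 - a) - x powr (1 - a) = (1 - a) * z powr (- a)" by auto
  have "(x + 1) powr (- a) \<le> z powr (- a)"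
    using z assms by (intro powr_mono2') auto
  then have "(a - 1) * (x + 1) powr (- a) \<le> (a - 1) * z powr (- a)"
    using assms by (intro mult_left_mono) auto
  then show ?thesis using z by (simp add: algebra_simps)
qed

text \<open>Summing \<open>powr_diff_ge\<close> telescopes and bounds all terms but the first, since
  that estimate concerns right endpoints; the first term accounts for the summand 1 in the
  constant.\<close>

lemma powr_tail_le:
  fixes a :: real
  assumes "a > 1"
  shows "(\<Sum>n. real (Suc (n + N)) powr (- a)) \<le> (1 + 1 / (a - 1)) * real (Suc N) powr (1 - a)"
proof -
  define f where "f = (\<lambda>n. real (Suc (n + N)) powr (- a))"
  define g where "g = (\<lambda>n. real (Suc (n + N)) powr (1 - a))"
  have sf: "summable f"
    using summable_Suc_powr[OF assms] unfolding f_def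
    by (rule summable_ignore_initial_segment)
  have le: "(a - 1) * f (Suc n) \<le> g n - g (Suc n)" for n
    using powr_diff_ge[OF assms, of "real (Suc (n + N))"] by (simp add: f_def g_def add_ac)
  have "filterlim (\<lambda>n. real (Suc (n + N))) at_top sequentially" by real_asymp
  then have "g \<longlonglongrightarrow> 0" unfolding g_def
    using assms by (intro tendsto_neg_powr) auto
  from telescope_sums'[OF this] have g: "(\<lambda>n. g n - g (Suc n)) sums g 0" by simp
  have "(a - 1) * (\<Sum>n. f (Suc n)) = (\<Sum>n. (a - 1) * f (Suc n))"
    using sf by (subst suminf_mult) (auto simp: summable_Suc_iff)
  also have "\<dots> \<le> g 0"
    unfolding sums_unique[OF g] using sf sums_summable[OF g] le
    by (intro suminf_le) (auto simp: summable_Suc_iff intro: summable_mult)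
  finally have "(\<Sum>n. f (Suc n)) \<le> g 0 / (a - 1)"
    using assms by (simp add: field_simps)
  moreover have "f 0 \<le> g 0" unfolding f_def g_def by (intro powr_mono) auto
  moreover have "suminf f = f 0 + (\<Sum>n. f (Suc n))" by (simp add: suminf_split_head[OF sf])
  ultimately have "suminf f \<le> (1 + 1 / (a - 1)) * g 0" by (simp add: algebra_simps)
  then show ?thesis by (simp add: f_def g_def)
qed

text \<open>Since \<open>Im s >= 1\<close>, the real part of each factor is absorbed into a multiple
  of \<open>Im s\<close>. The constant depends only on \<open>k\<close> and \<open>Re s\<close>, so
  it is uniform in the height.\<close>

lemma norm_falling_le:
  assumes "Im s \<ge> 1"
  shows "cmod (falling k s) \<le> (\<Prod>i<k. \<bar>1 - Re s\<bar> + real i + 1) * Im s ^ k"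
proof -
  have "cmod (falling k s) = (\<Prod>i<k. cmod (1 - s - of_nat i))"
    by (simp add: falling_def prod_norm)
  also have "\<dots> \<le> (\<Prod>i<k. (\<bar>1 - Re s\<bar> + real i + 1) * Im s)"
  proof (intro prod_mono conjI norm_ge_zero)
    fix i
    have "cmod (1 - s - of_nat i) \<le> \<bar>1 - Re s - real i\<bar> + \<bar>Im s\<bar>"
      using cmod_le[of "1 - s - of_nat i"] by simp
    also have "\<dots> \<le> (\<bar>1 - Re s\<bar> + real i) * 1 + Im s" using assms by simp
    also have "\<dots> \<le> (\<bar>1 - Re s\<bar> + real i) * Im s + Im s"
      using assms by (intro add_right_mono mult_left_mono) auto
    finally show "cmod (1 - s - of_nat i) \<le> (\<bar>1 - Re s\<bar> + real i + 1) * Im s"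
      by (simp add: algebra_simps)
  qed
  finally show ?thesis by (simp add: prod.distrib)
qed

text \<open>
  The identity \<^verbatim>\<open>zdiff_tail_sums\<close> expresses \<^verbatim>\<open>(1 - s) * zeta_tail N s\<close> through the tails at
  \<^verbatim>\<open>s + 1, ..., s + K - 1\<close>; each unit step to the right gains one factor \<^verbatim>\<open>t / N\<close> in the error,
  which drives the induction on \<^verbatim>\<open>K\<close>.
\<close>

lemma zeta_tail_bound:
  assumes "\<sigma> > 1 / 2" and "K \<ge> 1"
  shows "\<exists>C\<ge>0. \<forall>N t. 1 \<le> t \<and> t \<le> real (Suc N) \<longrightarrow>
    cmod (zeta_tail N (Complex \<sigma> t)) \<le> C * real (Suc N) powr (1 - \<sigma>) * (1 / t + (t / real (Suc N)) ^ K)"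
  using assms
proof (induction K arbitrary: \<sigma> rule: less_induct)
  case (less K \<sigma>)
  \<comment> \<open>The arguments further right only need the exponent \<open>K - 1\<close>. For
    \<open>K = 1\<close> the index set is empty, which is the base of the induction.\<close>
  have "\<forall>k\<in>{2..K}. \<exists>C\<ge>0. \<forall>N t. 1 \<le> t \<and> t \<le> real (Suc N) \<longrightarrow>
    cmod (zeta_tail N (Complex (\<sigma> + real k - 1) t)) \<le>
      C * real (Suc N) powr (1 - (\<sigma> + real k - 1)) * (1 / t + (t / real (Suc N)) ^ (K - 1))"
  proof
    fix k assume "k \<in> {2..K}"
    then show "\<exists>C\<ge>0. \<forall>N t. 1 \<le> t \<and> t \<le> real (Suc N) \<longrightarrow>
      cmod (zeta_tail N (Complex (\<sigma> + real k - 1) t)) \<le>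
        C * real (Suc N) powr (1 - (\<sigma> + real k - 1)) * (1 / t + (t / real (Suc N)) ^ (K - 1))"
      using less.prems by (intro less.IH) auto
  qed
  then obtain C where C0: "\<And>k. k \<in> {2..K} \<Longrightarrow> C k \<ge> 0"
    and C: "\<And>k N t. \<lbrakk>k \<in> {2..K}; 1 \<le> t; t \<le> real (Suc N)\<rbrakk> \<Longrightarrow>
      cmod (zeta_tail N (Complex (\<sigma> + real k - 1) t)) \<le>
        C k * real (Suc N) powr (1 - (\<sigma> + real k - 1)) * (1 / t + (t / real (Suc N)) ^ (K - 1))"
    unfolding bchoice_iff Ball_def by blast
  define F where "F = (\<lambda>k. \<Prod>i<k. \<bar>1 - \<sigma>\<bar> + real i + 1)"
  define B where "B = 1 + 1 / (\<sigma> + K - 1)"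
  have F0: "F k \<ge> 0" for k unfolding F_def by (intro prod_nonneg) auto
  have B0: "B \<ge> 0" unfolding B_def using less.prems by auto
  \<comment> \<open>The three summands pay for the Taylor remainder, the boundary power and the
    shifted tails; \<open>B\<close> is the constant of \<open>powr_tail_le\<close> at exponent
    \<open>\<sigma> + K\<close>.\<close>
  define E where "E = F (Suc K) * B + 1 + (\<Sum>k\<in>{2..K}. F k * C k)"
  have "E \<ge> 0" unfolding E_def using F0 B0 C0 by (intro add_nonneg_nonneg sum_nonneg mult_nonneg_nonneg) auto
  moreover have "cmod (zeta_tail N (Complex \<sigma> t)) \<le> E * real (Suc N) powr (1 - \<sigma>) * (1 / t + (t / real (Suc N)) ^ K)"
    if t: "1 \<le> t" "t \<le> real (Suc N)" for N t
  proof -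
    define s where "s = Complex \<sigma> t"
    define M where "M = real (Suc N)"
    define W where "W = M powr (1 - \<sigma>)"
    define q where "q = t / M"
    define X where "X = 1 / t + q ^ K"
    have M: "M > 0" by (simp add: M_def)
    have q: "0 < q" "q \<le> 1" using t by (auto simp: q_def M_def)
    have W0: "W \<ge> 0" by (simp add: W_def)
    have X: "1 / t \<le> X" "q ^ K \<le> X" "X \<ge> 0" using q t by (auto simp: X_def)
    have Wt: "W * t \<ge> 0" using W0 t by simp
    \<comment> \<open>Powers of \<open>t\<close> from the falling factors pair with the powers of
      \<open>M\<close> lost by shifting to the right; \<open>q\<close> is the resulting gain per
      step.\<close>
    have Mpow: "M powr (1 - \<sigma> - real k) * t ^ k = W * q ^ k" for k
      using M by (simp add: W_def q_def powr_diff powr_realpow power_divide)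
    have falling: "cmod (falling k s) \<le> F k * t ^ k" for k
      using norm_falling_le[of s k] t by (simp add: s_def F_def)
    define R where "R = complex_of_nat (Suc N) powr (1 - s) +
      (\<Sum>k\<in>{1..K}. falling k s / fact k * zeta_tail N (s + of_nat k - 1))"
    have sums: "(\<lambda>n. zdiff K (n + N) s) sums R"
      unfolding R_def using less.prems t by (intro zdiff_tail_sums) (auto simp: s_def)
    have sm: "summable (\<lambda>n. real (Suc (n + N)) powr (- (\<sigma> + K)))"
      using summable_ignore_initial_segment[OF summable_Suc_powr[of "\<sigma> + K"], of N] less.prems by simp
    have "cmod R = cmod (\<Sum>n. zdiff K (n + N) s)" using sums by (simp add: sums_iff)
    also have "\<dots> \<le> (\<Sum>n. cmod (falling (Suc K) s) * real (Suc (n + N)) powr (- (\<sigma> + K)))"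
    proof (rule norm_suminf_le)
      show "cmod (zdiff K (n + N) s) \<le> cmod (falling (Suc K) s) * real (Suc (n + N)) powr (- (\<sigma> + K))" for n
        using zdiff_bound[of K s "n + N"] less.prems by (simp add: s_def)
    qed (intro summable_mult sm)
    also have "\<dots> = cmod (falling (Suc K) s) * (\<Sum>n. real (Suc (n + N)) powr (- (\<sigma> + K)))"
      by (rule suminf_mult[OF sm])
    also have "\<dots> \<le> (F (Suc K) * t ^ Suc K) * (B * M powr (1 - (\<sigma> + K)))"
    proof (rule mult_mono)
      show "(\<Sum>n. real (Suc (n + N)) powr (- (\<sigma> + K))) \<le> B * M powr (1 - (\<sigma> + K))"
        using powr_tail_le[of "\<sigma> + K" N] less.prems by (simp add: B_def M_def)
      show "0 \<le> F (Suc K) * t ^ Suc K" using F0 t by simp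
    qed (use sm in \<open>auto intro!: falling suminf_nonneg simp del: power_Suc of_nat_Suc\<close>)
    also have "\<dots> = F (Suc K) * B * t * (M powr (1 - \<sigma> - real K) * t ^ K)"
      by (simp only: diff_diff_eq power_Suc mult_ac)
    also have "\<dots> = F (Suc K) * B * (W * t * q ^ K)" by (subst Mpow) (simp only: mult_ac)
    also have "\<dots> \<le> F (Suc K) * B * (W * t * X)"
      using F0 B0 Wt X by (intro mult_left_mono) auto
    finally have R: "cmod R \<le> F (Suc K) * B * (W * t * X)" .
    have summand: "cmod (falling k s / fact k * zeta_tail N (s + of_nat k - 1)) \<le> F k * C k * (W * t * X)"
      if k: "k \<in> {2..K}" for k
    proof -
      have "s + of_nat k - 1 = Complex (\<sigma> + real k - 1) t" by (simp add: s_def complex_eq_iff)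
      then have 1: "cmod (zeta_tail N (s + of_nat k - 1)) \<le>
          C k * M powr (1 - (\<sigma> + real k - 1)) * (1 / t + q ^ (K - 1))"
        using C[OF k t] by (simp add: M_def q_def)
      have "cmod (falling k s / fact k) \<le> cmod (falling k s) / 1"
        unfolding norm_divide by (intro divide_left_mono) (auto simp: fact_ge_1)
      then have "cmod (falling k s / fact k) \<le> F k * t ^ k" using falling[of k] by simp
      then have "cmod (falling k s / fact k * zeta_tail N (s + of_nat k - 1)) \<le>
          (F k * t ^ k) * (C k * M powr (1 - (\<sigma> + real k - 1)) * (1 / t + q ^ (K - 1)))"
        unfolding norm_mult using 1 F0 t by (intro mult_mono) auto
      \<comment> \<open>One factor \<open>t\<close> is set aside because only \<open>k - 1\<close>
        powers of \<open>M\<close> are available; it disappears in the final division by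
        \<open>1 - s\<close>.\<close>
      also have "\<dots> = F k * C k * (t * (M powr (1 - \<sigma> - real (k - 1)) * t ^ (k - 1)) * (1 / t + q ^ (K - 1)))"
        using k by (cases k) (auto simp: algebra_simps)
      also have "\<dots> = F k * C k * (W * t * (q ^ (k - 1) * (1 / t + q ^ (K - 1))))"
        unfolding Mpow by (simp add: algebra_simps)
      \<comment> \<open>Since \<open>k >= 2\<close>, at least one factor \<open>q\<close> is left;
        it raises the exponent \<open>K - 1\<close> of the induction hypothesis to
        \<open>K\<close>.\<close>
      also have "\<dots> \<le> F k * C k * (W * t * (q * (1 / t + q ^ (K - 1))))"
      proof (intro mult_left_mono mult_right_mono)
        have "1 \<le> k - 1" using k by auto
        from power_decreasing[OF this, of q] show "q ^ (k - 1) \<le> q" using q by simp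
      qed (use F0 C0[OF k] Wt q t in auto)
      also have "\<dots> \<le> F k * C k * (W * t * X)"
      proof (intro mult_left_mono)
        have "q * q ^ (K - 1) = q ^ K" using less.prems by (cases K) auto
        moreover have "q * (1 / t) \<le> 1 * (1 / t)" using q t by (intro mult_right_mono) auto
        ultimately show "q * (1 / t + q ^ (K - 1)) \<le> X" by (simp add: X_def ring_distribs)
      qed (use F0 C0[OF k] Wt in auto)
      finally show ?thesis .
    qed
    have "{1..K} = insert 1 {2..K}" using less.prems by auto
    \<comment> \<open>The summand for \<open>k = 1\<close> has coefficient \<open>1 - s\<close>, so
      the identity can be solved for the tail at \<open>s\<close> itself.\<close>
    then have eq: "(1 - s) * zeta_tail N s = R - of_nat (Suc N) powr (1 - s) -
       (\<Sum>k\<in>{2..K}. falling k s / fact k * zeta_tail N (s + of_nat k - 1))"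
      by (simp add: R_def falling_def)
    have "cmod ((1 - s) * zeta_tail N s) \<le> cmod R + cmod (complex_of_nat (Suc N) powr (1 - s)) +
       cmod (\<Sum>k\<in>{2..K}. falling k s / fact k * zeta_tail N (s + of_nat k - 1))"
      unfolding eq by (intro order.trans[OF norm_triangle_ineq4] add_right_mono norm_triangle_ineq4)
    also have "cmod (complex_of_nat (Suc N) powr (1 - s)) = W"
      using norm_powr_real_powr[of "of_nat (Suc N)" "1 - s"]
      by (simp add: W_def M_def s_def del: of_nat_Suc)
    also have "W = W * t * (1 / t)" using t by simp
    also have "\<dots> \<le> W * t * X" using Wt X by (intro mult_left_mono) auto
    also have "cmod (\<Sum>k\<in>{2..K}. falling k s / fact k * zeta_tail N (s + of_nat k - 1))
        \<le> (\<Sum>k\<in>{2..K}. F k * C k * (W * t * X))"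
      by (intro sum_norm_le summand)
    also note R
    finally have "cmod ((1 - s) * zeta_tail N s) \<le> E * (W * t * X)"
      by (simp add: E_def algebra_simps sum_distrib_left sum_distrib_right)
    \<comment> \<open>The imaginary part of \<open>1 - s\<close> has absolute value
      \<open>t\<close>.\<close>
    moreover have "t * cmod (zeta_tail N s) \<le> cmod ((1 - s) * zeta_tail N s)"
      unfolding norm_mult using abs_Im_le_cmod[of "1 - s"] t
      by (intro mult_right_mono) (auto simp: s_def)
    ultimately have "t * cmod (zeta_tail N s) \<le> t * (E * W * X)"
      by (simp add: algebra_simps)
    then have "cmod (zeta_tail N s) \<le> E * W * X" using t by simp
    then show ?thesis by (simp add: s_def W_def X_def M_def q_def)
  qed
  ultimately show ?case by blast
qed

section \<open>Mean squares of Dirichlet polynomials\<close>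

text \<open>Expand the square: the diagonal gives the main term, and each off-diagonal cosine is
  integrated explicitly. Taking absolute values there costs only logarithms for Dirichlet
  polynomials.\<close>

lemma trig_poly_mean_square:
  fixes a w :: "'i \<Rightarrow> real"
  assumes "finite A" and "inj_on w A" and "T \<ge> 1"
  shows "\<bar>integral {1..T} (\<lambda>t. (cmod (\<Sum>n\<in>A. of_real (a n) * cis (- (t * w n))))\<^sup>2)
            - (T - 1) * (\<Sum>n\<in>A. (a n)\<^sup>2)\<bar>
         \<le> (\<Sum>m\<in>A. \<Sum>n\<in>A-{m}. 2 * \<bar>a m * a n\<bar> / \<bar>w m - w n\<bar>)"
proof -
  \<comment> \<open>The zero frequency needs its own case: division by zero would give 0 instead of
    the length \<open>T - 1\<close>.\<close>
  define J where "J = (\<lambda>c. if c = 0 then T - 1 else (sin (T * c) - sin (1 * c)) / c)"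
  have J: "((\<lambda>t. cos (t * c)) has_integral J c) {1..T}" for c
  proof (cases "c = 0")
    case True
    then show ?thesis using has_integral_const_real[of "1::real" 1 T] assms(3) by (simp add: J_def)
  next
    case False
    have "((\<lambda>t. cos (t * c)) has_integral (sin (T * c) / c - sin (1 * c) / c)) {1..T}"
      using assms(3) False
      by (intro fundamental_theorem_of_calculus)
         (auto intro!: derivative_eq_intros simp: has_real_derivative_iff_has_vector_derivative[symmetric])
    then show ?thesis using False by (simp add: J_def diff_divide_distrib)
  qed
  have sq: "(cmod (\<Sum>n\<in>A. of_real (a n) * cis (- (t * w n))))\<^sup>2
      = (\<Sum>m\<in>A. \<Sum>n\<in>A. a m * a n * cos (t * (w m - w n)))" for t
    unfolding cmod_power2
    by (simp add: Re_sum Im_sum power2_eq_square sum_product sum_negf right_diff_distrib cos_diff algebra_simps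
          flip: sum.distrib)
  have "((\<lambda>t. \<Sum>m\<in>A. \<Sum>n\<in>A. a m * a n * cos (t * (w m - w n))) has_integral
      (\<Sum>m\<in>A. \<Sum>n\<in>A. a m * a n * J (w m - w n))) {1..T}"
    by (intro has_integral_sum has_integral_mult_right J assms)
  then have "integral {1..T} (\<lambda>t. (cmod (\<Sum>n\<in>A. of_real (a n) * cis (- (t * w n))))\<^sup>2)
      = (\<Sum>m\<in>A. \<Sum>n\<in>A. a m * a n * J (w m - w n))"
    unfolding sq by (rule integral_unique)
  also have "\<dots> = (\<Sum>m\<in>A. (a m)\<^sup>2 * (T - 1) + (\<Sum>n\<in>A-{m}. a m * a n * J (w m - w n)))"
    using assms by (intro sum.cong refl) (auto simp: sum.remove J_def power2_eq_square)
  finally have "integral {1..T} (\<lambda>t. (cmod (\<Sum>n\<in>A. of_real (a n) * cis (- (t * w n))))\<^sup>2)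
      - (T - 1) * (\<Sum>n\<in>A. (a n)\<^sup>2) = (\<Sum>m\<in>A. \<Sum>n\<in>A-{m}. a m * a n * J (w m - w n))"
    by (simp add: sum.distrib sum_distrib_left mult.commute)
  also have "\<bar>\<dots>\<bar> \<le> (\<Sum>m\<in>A. \<Sum>n\<in>A-{m}. \<bar>a m * a n * J (w m - w n)\<bar>)"
    by (intro order.trans[OF sum_abs] sum_mono sum_abs)
  also have "\<dots> \<le> (\<Sum>m\<in>A. \<Sum>n\<in>A-{m}. 2 * \<bar>a m * a n\<bar> / \<bar>w m - w n\<bar>)"
  proof (intro sum_mono)
    fix m n assume mn: "m \<in> A" "n \<in> A - {m}"
    then have ne: "w m - w n \<noteq> 0" using assms(2) by (auto dest: inj_onD)
    have "\<bar>sin (T * (w m - w n)) - sin (1 * (w m - w n))\<bar> \<le> 2"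
      using abs_sin_le_one[of "T * (w m - w n)"] abs_sin_le_one[of "1 * (w m - w n)"] by linarith
    then have "\<bar>J (w m - w n)\<bar> \<le> 2 / \<bar>w m - w n\<bar>"
      using ne by (simp add: J_def divide_right_mono)
    then have "\<bar>a m * a n\<bar> * \<bar>J (w m - w n)\<bar> \<le> \<bar>a m * a n\<bar> * (2 / \<bar>w m - w n\<bar>)"
      by (intro mult_left_mono) auto
    then show "\<bar>a m * a n * J (w m - w n)\<bar> \<le> 2 * \<bar>a m * a n\<bar> / \<bar>w m - w n\<bar>"
      by (simp add: abs_mult algebra_simps)
  qed
  finally show ?thesis .
qed

text \<open>This is \<open>ln u <= u - 1\<close> at the ratio of the smaller to the larger number.
  It replaces logarithmic frequency gaps by integer gaps.\<close>

lemma abs_ln_diff_ge: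
  fixes x y :: real
  assumes "x > 0" and "y > 0"
  shows "\<bar>x - y\<bar> / max x y \<le> \<bar>ln x - ln y\<bar>"
proof -
  have *: "(v - u) / v \<le> ln v - ln u" if "0 < u" "u \<le> v" for u v :: real
    using ln_le_minus_one[of "u / v"] that by (simp add: ln_div diff_divide_distrib)
  show ?thesis
  proof (cases "x \<le> y")
    case True
    then show ?thesis using *[of x y] assms by (simp add: abs_minus_commute max_def)
  next
    case False
    then show ?thesis using *[of y x] assms by (simp add: max_def)
  qed
qed

text \<open>On either side of \<open>m\<close> the distances to \<open>m\<close> are distinct
  integers between 1 and \<open>N\<close>, so each side contributes at most one harmonic
  sum.\<close>

lemma sum_inverse_diff_le_harm:
  assumes "m \<in> {1..N}"
  shows "(\<Sum>n\<in>{1..N}-{m}. 1 / \<bar>real m - real n\<bar>) \<le> 2 * harm N"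
proof -
  have *: "(\<Sum>n\<in>A. 1 / \<bar>real m - real n\<bar>) \<le> harm N"
    if "inj_on f A" "f ` A \<subseteq> {1..N}" "\<And>n. n \<in> A \<Longrightarrow> real (f n) = \<bar>real m - real n\<bar>" for A and f :: "nat \<Rightarrow> nat"
  proof -
    have "(\<Sum>n\<in>A. 1 / \<bar>real m - real n\<bar>) = (\<Sum>n\<in>A. 1 / real (f n))"
      by (intro sum.cong refl arg_cong2[where f = "(/)"] that(3)[symmetric])
    also have "\<dots> = (\<Sum>d\<in>f ` A. 1 / real d)"
      by (simp add: sum.reindex[OF that(1)])
    also have "\<dots> \<le> (\<Sum>d\<in>{1..N}. 1 / real d)"
      by (rule sum_mono2[OF finite_atLeastAtMost that(2)]) simp
    finally show ?thesis by (simp add: harm_def inverse_eq_divide)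
  qed
  have split: "{1..N} - {m} = {1..<m} \<union> {m<..N}" using assms by auto
  have "(\<Sum>n\<in>{1..N}-{m}. 1 / \<bar>real m - real n\<bar>) =
     (\<Sum>n\<in>{1..<m}. 1 / \<bar>real m - real n\<bar>) + (\<Sum>n\<in>{m<..N}. 1 / \<bar>real m - real n\<bar>)"
    unfolding split by (rule sum.union_disjoint) auto
  also have "(\<Sum>n\<in>{1..<m}. 1 / \<bar>real m - real n\<bar>) \<le> harm N"
  proof (rule *[of "\<lambda>n. m - n"])
    show "inj_on (\<lambda>n. m - n) {1..<m}" by (auto simp: inj_on_def)
    show "(\<lambda>n. m - n) ` {1..<m} \<subseteq> {1..N}" using assms by auto
    show "real (m - n) = \<bar>real m - real n\<bar>" if "n \<in> {1..<m}" for n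
      using that by (simp add: of_nat_diff)
  qed
  also have "(\<Sum>n\<in>{m<..N}. 1 / \<bar>real m - real n\<bar>) \<le> harm N"
  proof (rule *[of "\<lambda>n. n - m"])
    show "inj_on (\<lambda>n. n - m) {m<..N}" by (auto simp: inj_on_def)
    show "(\<lambda>n. n - m) ` {m<..N} \<subseteq> {1..N}" by auto
    show "real (n - m) = \<bar>real m - real n\<bar>" if "n \<in> {m<..N}" for n
      using that by (simp add: of_nat_diff)
  qed
  finally show ?thesis by simp
qed

text \<open>Each weight is at most \<open>N powr (1 - \<sigma>')\<close> divided by its index, after
  which only harmonic sums remain. The parameter \<open>\<sigma>'\<close> keeps
  \<open>1 - \<sigma>'\<close> nonnegative even for \<open>\<sigma> > 1\<close>.\<close>

lemma off_diagonal_le: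
  fixes \<sigma> \<sigma>' :: real
  assumes "\<sigma>' \<le> \<sigma>" and "\<sigma>' \<le> 1"
  shows "(\<Sum>m\<in>{1..N}. \<Sum>n\<in>{1..N}-{m}.
            2 * \<bar>real m powr (- \<sigma>) * real n powr (- \<sigma>)\<bar> / \<bar>ln (real m) - ln (real n)\<bar>)
         \<le> 6 * real N powr (2 - 2 * \<sigma>') * (harm N)\<^sup>2"
proof -
  define P where "P = real N powr (2 - 2 * \<sigma>')"
  have P0: "P \<ge> 0" by (simp add: P_def)
  have pw: "real m powr (- \<sigma>) \<le> real N powr (1 - \<sigma>') / real m" if "m \<in> {1..N}" for m
  proof -
    have "real m powr (- \<sigma>) \<le> real m powr (- \<sigma>')" using assms that by (intro powr_mono) auto
    also have "\<dots> = real m powr (1 - \<sigma>') / real m" using that by (simp add: powr_diff powr_minus field_simps)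
    also have "\<dots> \<le> real N powr (1 - \<sigma>') / real m" using assms that
      by (intro divide_right_mono powr_mono2) auto
    finally show ?thesis .
  qed
  have summand: "2 * \<bar>real m powr (- \<sigma>) * real n powr (- \<sigma>)\<bar> / \<bar>ln (real m) - ln (real n)\<bar>
      \<le> 2 * P * (1 / real m) * (1 / real n + 1 / \<bar>real m - real n\<bar>)"
    if m: "m \<in> {1..N}" and n: "n \<in> {1..N} - {m}" for m n
  proof -
    define d where "d = \<bar>real m - real n\<bar>"
    have d: "d > 0" using n by (auto simp: d_def)
    have mn: "real m > 0" "real n > 0" using m n by auto
    have "real m powr (- \<sigma>) * real n powr (- \<sigma>) \<le>
       (real N powr (1 - \<sigma>') / real m) * (real N powr (1 - \<sigma>') / real n)"
      using m n by (intro mult_mono pw) auto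
    also have "\<dots> = P / (real m * real n)"
      by (simp add: P_def flip: powr_add)
    finally have 1: "2 * \<bar>real m powr (- \<sigma>) * real n powr (- \<sigma>)\<bar> \<le> 2 * (P / (real m * real n))"
      by simp
    have 2: "d / max (real m) (real n) \<le> \<bar>ln (real m) - ln (real n)\<bar>"
      unfolding d_def by (intro abs_ln_diff_ge mn)
    have pos: "d / max (real m) (real n) > 0" using d mn by (simp add: max_def)
    have "2 * \<bar>real m powr (- \<sigma>) * real n powr (- \<sigma>)\<bar> / \<bar>ln (real m) - ln (real n)\<bar>
       \<le> 2 * (P / (real m * real n)) / (d / max (real m) (real n))"
      by (intro frac_le 1 2 pos) (use P0 mn in auto)
    also have "\<dots> = 2 * P * (max (real m) (real n) / (real m * real n * d))"
      using d mn by (simp add: field_simps)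
    also have "\<dots> \<le> 2 * P * ((1 / real m) * (1 / real n + 1 / d))"
    proof (intro mult_left_mono)
      \<comment> \<open>This splits the maximum into a part that cancels \<open>n\<close> and a part
        that cancels \<open>d\<close>.\<close>
      have "max (real m) (real n) \<le> real n + d" unfolding d_def by linarith
      then have "max (real m) (real n) / (real m * real n * d) \<le> (real n + d) / (real m * real n * d)"
        using d mn by (intro divide_right_mono) auto
      also have "\<dots> = (1 / real m) * (1 / real n + 1 / d)" using d mn by (simp add: field_simps)
      finally show "max (real m) (real n) / (real m * real n * d) \<le> (1 / real m) * (1 / real n + 1 / d)" .
    qed (use P0 in auto)
    finally show ?thesis by (simp add: d_def)
  qed
  have harm: "harm N = (\<Sum>n\<in>{1..N}. 1 / real n)" by (simp add: harm_def inverse_eq_divide)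
  have "(\<Sum>m\<in>{1..N}. \<Sum>n\<in>{1..N}-{m}.
            2 * \<bar>real m powr (- \<sigma>) * real n powr (- \<sigma>)\<bar> / \<bar>ln (real m) - ln (real n)\<bar>)
      \<le> (\<Sum>m\<in>{1..N}. \<Sum>n\<in>{1..N}-{m}. 2 * P * (1 / real m) * (1 / real n + 1 / \<bar>real m - real n\<bar>))"
    by (intro sum_mono summand)
  \<comment> \<open>The factor 3 is one harmonic sum for the terms \<open>1 / n\<close> and two for
    the inverse distances.\<close>
  also have "\<dots> \<le> (\<Sum>m\<in>{1..N}. 2 * P * (1 / real m) * (3 * harm N))"
  proof (intro sum_mono)
    fix m assume m: "m \<in> {1..N}"
    have "(\<Sum>n\<in>{1..N}-{m}. 1 / real n) \<le> harm N" unfolding harm by (intro sum_mono2) auto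
    then have "(\<Sum>n\<in>{1..N}-{m}. 1 / real n + 1 / \<bar>real m - real n\<bar>) \<le> 3 * harm N"
      using sum_inverse_diff_le_harm[OF m] by (simp add: sum.distrib)
    then show "(\<Sum>n\<in>{1..N}-{m}. 2 * P * (1 / real m) * (1 / real n + 1 / \<bar>real m - real n\<bar>))
       \<le> 2 * P * (1 / real m) * (3 * harm N)"
      unfolding sum_distrib_left[symmetric] using P0 by (intro mult_left_mono) auto
  qed
  also have "\<dots> = 2 * P * (\<Sum>m\<in>{1..N}. 1 / real m) * (3 * harm N)"
    by (simp only: sum_distrib_left sum_distrib_right)
  also note harm[symmetric]
  finally show ?thesis by (simp add: P_def power2_eq_square algebra_simps)
qed

text \<open>The terms have amplitude \<open>n powr (- \<sigma>)\<close> and frequency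
  \<open>ln n\<close>; distinct \<open>n\<close> have distinct frequencies, so
  \<open>trig_poly_mean_square\<close> and \<open>off_diagonal_le\<close> combine.\<close>

lemma dirichlet_poly_mean_square:
  fixes \<sigma> \<sigma>' :: real
  assumes "\<sigma>' \<le> \<sigma>" and "\<sigma>' \<le> 1" and "T \<ge> 1"
  shows "\<bar>integral {1..T} (\<lambda>t. (cmod (\<Sum>n<N. 1 / of_nat (Suc n) powr Complex \<sigma> t))\<^sup>2)
            - (T - 1) * (\<Sum>n<N. real (Suc n) powr (- (2 * \<sigma>)))\<bar>
         \<le> 6 * real N powr (2 - 2 * \<sigma>') * (harm N)\<^sup>2"
proof -
  have eq: "1 / of_nat (Suc n) powr Complex \<sigma> t = of_real (real (Suc n) powr (- \<sigma>)) * cis (- (t * ln (real (Suc n))))" for n t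
  proof -
    have "1 / of_nat (Suc n) powr Complex \<sigma> t = (of_real (real (Suc n)) :: complex) powr (- Complex \<sigma> t)"
      by (simp add: powr_minus inverse_eq_divide)
    also have "\<dots> = exp (- Complex \<sigma> t * of_real (ln (real (Suc n))))"
      by (simp add: powr_def Ln_of_real del: of_nat_Suc)
    also have "\<dots> = of_real (real (Suc n) powr (- \<sigma>)) * cis (- (t * ln (real (Suc n))))"
      by (simp add: exp_eq_polar powr_def del: of_nat_Suc)
    finally show ?thesis .
  qed
  have poly: "(\<Sum>n<N. 1 / of_nat (Suc n) powr Complex \<sigma> t) =
      (\<Sum>n\<in>{1..N}. of_real (real n powr (- \<sigma>)) * cis (- (t * ln (real n))))" for t
    by (simp only: eq sum.atLeast1_atMost_eq One_nat_def)
  have squares: "(\<Sum>n<N. real (Suc n) powr (- (2 * \<sigma>))) = (\<Sum>n\<in>{1..N}. (real n powr (- \<sigma>))\<^sup>2)"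
    unfolding One_nat_def sum.atLeast1_atMost_eq
    by (intro sum.cong refl) (simp add: power2_eq_square flip: powr_add)
  have "inj_on (\<lambda>n. ln (real n)) {1..N}" by (auto simp: inj_on_def)
  from order.trans[OF trig_poly_mean_square[OF finite_atLeastAtMost this assms(3)] off_diagonal_le[OF assms(1,2)]]
  show ?thesis unfolding poly squares .
qed

section \<open>Mean square of zeta to the right of the critical line\<close>

lemma zeta_real_sums:
  assumes "x > 1"
  shows "(\<lambda>n. real (Suc n) powr (- x)) sums Re (zeta (of_real x))"
proof -
  have "1 / of_nat (Suc n) powr complex_of_real x = of_real (real (Suc n) powr (- x))" for n
    using powr_of_real[of "real (Suc n)" x] by (simp add: powr_minus inverse_eq_divide del: of_nat_Suc)
  then show ?thesis
    using sums_Re[OF zeta_sums[of "of_real x"]] assms by (simp del: of_nat_Suc)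
qed

lemma zeta_real_pos: "x > 1 \<Longrightarrow> Re (zeta (of_real x)) > 0"
  using zeta_real_sums[of x] suminf_pos[of "\<lambda>n. real (Suc n) powr (- x)"]
  by (auto simp: sums_iff simp del: of_nat_Suc)

text \<open>The cross term is absorbed pointwise by
  \<open>2 a b <= \<delta> a^2 + b^2 / \<delta>\<close>. The weight \<open>\<delta>\<close> stays
  free so that it can be chosen in terms of the interval.\<close>

lemma integral_norm_add_square:
  fixes f g :: "real \<Rightarrow> 'a::real_normed_vector"
  assumes f: "continuous_on {a..b} f" and g: "continuous_on {a..b} g" and "\<delta> > 0"
  shows "\<bar>integral {a..b} (\<lambda>t. (norm (f t + g t))\<^sup>2) - integral {a..b} (\<lambda>t. (norm (f t))\<^sup>2)\<bar>
    \<le> \<delta> * integral {a..b} (\<lambda>t. (norm (f t))\<^sup>2) + (1 + 1 / \<delta>) * integral {a..b} (\<lambda>t. (norm (g t))\<^sup>2)"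
proof -
  have int: "(\<lambda>t. (norm (h t))\<^sup>2) integrable_on {a..b}" if "continuous_on {a..b} h" for h :: "real \<Rightarrow> 'a"
    using that by (intro integrable_continuous_interval continuous_intros)
  note i = int[OF f] int[OF g] int[OF continuous_on_add[OF f g]]
  have le: "\<bar>(norm (x + y))\<^sup>2 - (norm x)\<^sup>2\<bar> \<le> \<delta> * (norm x)\<^sup>2 + (1 + 1 / \<delta>) * (norm y)\<^sup>2" for x y :: 'a
  proof -
    have "\<bar>(norm (x + y))\<^sup>2 - (norm x)\<^sup>2\<bar> = \<bar>norm (x + y) - norm x\<bar> * (norm (x + y) + norm x)"
      by (simp add: power2_eq_square abs_mult square_diff_square_factored)
    also have "\<dots> \<le> norm y * ((norm x + norm y) + norm x)"
      using norm_triangle_ineq3[of "x + y" x] norm_triangle_ineq[of x y]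
      by (intro mult_mono) auto
    also have "\<dots> = 2 * norm x * norm y + (norm y)\<^sup>2" by (simp add: power2_eq_square algebra_simps)
    also have "2 * norm x * norm y \<le> \<delta> * (norm x)\<^sup>2 + (norm y)\<^sup>2 / \<delta>"
    proof -
      have "0 \<le> (\<delta> * norm x - norm y)\<^sup>2 / \<delta>" using assms(3) by simp
      also have "\<dots> = \<delta> * (norm x)\<^sup>2 + (norm y)\<^sup>2 / \<delta> - 2 * norm x * norm y"
        using assms(3) by (simp add: power2_eq_square field_simps)
      finally show ?thesis by simp
    qed
    finally show ?thesis by (simp add: algebra_simps)
  qed
  have "norm (integral {a..b} (\<lambda>t. (norm (f t + g t))\<^sup>2 - (norm (f t))\<^sup>2))
     \<le> integral {a..b} (\<lambda>t. \<delta> * (norm (f t))\<^sup>2 + (1 + 1 / \<delta>) * (norm (g t))\<^sup>2)"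
    by (intro integral_norm_bound_integral integrable_diff integrable_add integrable_on_mult_right i)
       (use le in auto)
  also have "\<dots> = \<delta> * integral {a..b} (\<lambda>t. (norm (f t))\<^sup>2) + (1 + 1 / \<delta>) * integral {a..b} (\<lambda>t. (norm (g t))\<^sup>2)"
    by (simp add: integral_add integrable_on_mult_right i)
  finally show ?thesis by (simp add: integral_diff i)
qed

lemma has_integral_inverse_square:
  fixes T :: real
  assumes "T \<ge> 1"
  shows "((\<lambda>t. 1 / t\<^sup>2) has_integral (1 - 1 / T)) {1..T}"
proof -
  have "((\<lambda>t. 1 / t\<^sup>2) has_integral (- 1 / T - (- 1 / 1))) {1..T}"
    using assms
    by (intro fundamental_theorem_of_calculus)
       (auto intro!: derivative_eq_intros
          simp: power2_eq_square simp flip: has_real_derivative_iff_has_vector_derivative)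
  then show ?thesis by simp
qed

lemma zeta_mean_square:
  assumes "\<sigma> > 1 / 2"
  shows "((\<lambda>T. integral {1..T} (\<lambda>t. (cmod (zeta (Complex \<sigma> t)))\<^sup>2) / T)
           \<longlongrightarrow> Re (zeta (of_real (2 * \<sigma>)))) at_top"
proof -
  \<comment> \<open>Replacing \<sigma> by \<open>\<sigma>' < 1\<close> in the upper bounds keeps \<open>p\<close> positive and covers \<open>\<sigma> \<ge> 1\<close>
    as well; \<open>q\<close> lies strictly between 1 and \<open>1 / p\<close>.\<close>
  define \<sigma>' p q where "\<sigma>' = min \<sigma> (3 / 4)" and "p = 2 - 2 * \<sigma>'" and "q = 2 / (1 + p)"
  have \<sigma>': "1 / 2 < \<sigma>'" "\<sigma>' \<le> \<sigma>" "\<sigma>' \<le> 1" using assms by (auto simp: \<sigma>'_def)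
  have p: "0 \<le> p" "p < 1" using \<sigma>' by (auto simp: p_def)
  have q: "q > 1" "p * q < 1" using p by (auto simp: q_def field_simps)
  define e where "e = p * q"
  \<comment> \<open>\<open>K\<close> makes \<open>(T powr (1 - q)) ^ K\<close> at most
    \<open>1 / T\<close>; the second error term of \<open>zeta_tail_bound\<close> is then no larger
    than the first.\<close>
  obtain K0 :: nat where K0: "real K0 > 1 / (q - 1)" using reals_Archimedean2 by blast
  define K where "K = Suc K0"
  have K: "K \<ge> 1" "(q - 1) * real K \<ge> 1"
    using K0 q by (auto simp: K_def field_simps)
  obtain C where C0: "C \<ge> 0" and C: "\<And>N t. \<lbrakk>1 \<le> t; t \<le> real (Suc N)\<rbrakk> \<Longrightarrow>
      cmod (zeta_tail N (Complex \<sigma> t)) \<le> C * real (Suc N) powr (1 - \<sigma>) * (1 / t + (t / real (Suc N)) ^ K)"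
    using zeta_tail_bound[OF assms K(1)] by blast
  \<comment> \<open>Rounding up, with \<open>q > 1\<close>, makes \<open>N T\<close> at least
    \<open>T\<close>, so the tail bound applies to every \<open>t\<close> in
    \<open>{1..T}\<close>.\<close>
  define N where "N = (\<lambda>T. nat \<lceil>T powr q\<rceil>)"
  define D where "D = (\<lambda>N s. \<Sum>n<N. 1 / complex_of_nat (Suc n) powr s)"
  define I where "I = (\<lambda>T. integral {1..T} (\<lambda>t. (cmod (zeta (Complex \<sigma> t)))\<^sup>2))"
  define P where "P = (\<lambda>T. integral {1..T} (\<lambda>t. (cmod (D (N T) (Complex \<sigma> t)))\<^sup>2))"
  define R where "R = (\<lambda>T. integral {1..T} (\<lambda>t. (cmod (zeta_tail (N T) (Complex \<sigma> t)))\<^sup>2))"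
  define S where "S = (\<lambda>N. \<Sum>n<N. real (Suc n) powr (- (2 * \<sigma>)))"

  have cont_line: "continuous_on X (\<lambda>t. Complex \<sigma> t)" for X
    unfolding Complex_eq by (intro continuous_intros)
  have cont_D: "continuous_on X (\<lambda>t. D N (Complex \<sigma> t))" for X N
  proof -
    have "D N holomorphic_on UNIV" unfolding D_def by (intro holomorphic_intros) auto
    then have "continuous_on UNIV (D N)" by (rule holomorphic_on_imp_continuous_on)
    then show ?thesis by (rule continuous_on_compose2[OF _ cont_line]) auto
  qed
  have cont_zeta: "continuous_on {1..T} (\<lambda>t. zeta (Complex \<sigma> t))" for T
    by (rule continuous_on_compose2[OF holomorphic_on_imp_continuous_on[OF zeta_holomorphic] cont_line])
       (auto simp: complex_eq_iff)
  have tail: "zeta_tail N s = zeta s - D N s" for N s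
    by (simp add: zeta_tail_def D_def)
  have cont_tail: "continuous_on {1..T} (\<lambda>t. zeta_tail N (Complex \<sigma> t))" for T N
    unfolding tail by (intro continuous_intros cont_zeta cont_D)

  have NT: "T powr q \<le> real (N T)" "real (N T) \<le> 2 * T powr q" "real (Suc (N T)) \<le> 3 * T powr q"
    "T \<le> real (Suc (N T))" if "T \<ge> 1" for T
  proof -
    have "T powr 1 \<le> T powr q" using that q by (intro powr_mono) auto
    then have "1 \<le> T powr q" "T \<le> T powr q" using that by auto
    then show "T powr q \<le> real (N T)" "real (N T) \<le> 2 * T powr q" "real (Suc (N T)) \<le> 3 * T powr q"
      "T \<le> real (Suc (N T))"
      unfolding N_def by linarith+
  qed

  \<comment> \<open>Pointwise the tail is \<open>O(M powr (1 - \<sigma>') / t)\<close>. The integral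
    of \<open>1 / t^2\<close> stays bounded, so the total is of order \<open>M powr p\<close>, hence
    \<open>T powr e\<close>.\<close>
  have R_le: "R T \<le> 4 * C\<^sup>2 * 3 powr p * T powr e" if T: "T \<ge> 1" for T
  proof -
    define M where "M = real (Suc (N T))"
    have M: "1 \<le> M" "T powr q \<le> M" "T \<le> M" "M \<le> 3 * T powr q"
      using NT[OF T] by (auto simp: M_def)
    have "(cmod (zeta_tail (N T) (Complex \<sigma> t)))\<^sup>2 \<le> 4 * C\<^sup>2 * M powr p * (1 / t\<^sup>2)"
      if t: "t \<in> {1..T}" for t
    proof -
      have "t / M \<le> T / T powr q" using t M T by (intro frac_le) auto
      also have "\<dots> = T powr (1 - q)" using T by (simp add: powr_diff)
      finally have "(t / M) ^ K \<le> (T powr (1 - q)) ^ K" using t M by (intro power_mono) auto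
      also have "\<dots> = T powr ((1 - q) * real K)" using T by (simp add: powr_powr flip: powr_realpow)
      also have "\<dots> \<le> T powr (- 1)" using T K by (intro powr_mono) (auto simp: algebra_simps)
      also have "\<dots> \<le> 1 / t" using t T by (simp add: powr_minus field_simps)
      finally have "C * M powr (1 - \<sigma>) * (1 / t + (t / M) ^ K) \<le> C * M powr (1 - \<sigma>') * (1 / t + 1 / t)"
        using C0 M \<sigma>' t by (intro mult_mono powr_mono) auto
      then have "cmod (zeta_tail (N T) (Complex \<sigma> t)) \<le> C * M powr (1 - \<sigma>') * (2 / t)"
        using C[of t "N T"] t M by (simp add: M_def)
      then have "(cmod (zeta_tail (N T) (Complex \<sigma> t)))\<^sup>2 \<le> (C * M powr (1 - \<sigma>') * (2 / t))\<^sup>2"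
        by (intro power_mono) auto
      also have "(M powr (1 - \<sigma>'))\<^sup>2 = M powr p"
        by (simp add: p_def power2_eq_square flip: powr_add)
      then have "(C * M powr (1 - \<sigma>') * (2 / t))\<^sup>2 = 4 * C\<^sup>2 * M powr p * (1 / t\<^sup>2)"
        by (simp add: power_mult_distrib power_divide)
      finally show ?thesis .
    qed
    then have "R T \<le> integral {1..T} (\<lambda>t. 4 * C\<^sup>2 * M powr p * (1 / t\<^sup>2))"
      unfolding R_def using has_integral_inverse_square[OF T]
      by (intro integral_le integrable_continuous_interval[of 1 T "\<lambda>t. (cmod (zeta_tail (N T) (Complex \<sigma> t)))\<^sup>2"]
                continuous_intros cont_tail integrable_on_mult_right) auto
    also have "\<dots> = 4 * C\<^sup>2 * M powr p * (1 - 1 / T)"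
      using has_integral_inverse_square[OF T] by (simp only: integral_mult_right integral_unique)
    also have "\<dots> \<le> 4 * C\<^sup>2 * M powr p * 1" using T by (intro mult_left_mono) auto
    also have "\<dots> \<le> 4 * C\<^sup>2 * (3 * T powr q) powr p * 1"
      using M p by (intro mult_left_mono mult_right_mono powr_mono2) auto
    also have "(3 * T powr q) powr p = 3 powr p * T powr e"
      by (simp add: powr_mult powr_powr e_def mult.commute)
    finally show ?thesis by simp
  qed

  have P_le: "\<bar>P T - (T - 1) * S (N T)\<bar> \<le> 6 * (2 powr p * T powr e) * (1 + ln (2 * T powr q))\<^sup>2"
    if T: "T \<ge> 1" for T
  proof -
    have NT_pos: "N T > 0" using NT(1)[OF T] T by (cases "N T") (auto simp: powr_eq_0_iff)
    \<comment> \<open>The sequence \<open>harm n - ln n\<close> decreases and equals 1 at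
      \<open>n = 1\<close>.\<close>
    have "harm (N T) \<le> 1 + ln (real (N T))"
      using euler_mascheroni_sequence_decreasing[of 1 "N T"] NT_pos by (simp add: harm_expand)
    also have "\<dots> \<le> 1 + ln (2 * T powr q)" using NT_pos NT(2)[OF T] T by simp
    finally have h: "harm (N T) \<le> 1 + ln (2 * T powr q)" .
    have "\<bar>P T - (T - 1) * S (N T)\<bar> \<le> 6 * real (N T) powr p * (harm (N T))\<^sup>2"
      unfolding P_def S_def D_def p_def using dirichlet_poly_mean_square[OF \<sigma>'(2,3) T] .
    also have "\<dots> \<le> 6 * (2 * T powr q) powr p * (1 + ln (2 * T powr q))\<^sup>2"
      using NT[OF T] p h by (intro mult_mono powr_mono2 power_mono harm_nonneg) auto
    also have "(2 * T powr q) powr p = 2 powr p * T powr e"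
      by (simp add: powr_mult powr_powr e_def mult.commute)
    finally show ?thesis .
  qed

  have e: "e < 1" using q by (simp add: e_def)
  \<comment> \<open>With the weight \<open>\<delta> = T powr (- d)\<close> below, the tail
    contributes order \<open>T powr (d + e - 1) = T powr (- d)\<close> after division by
    \<open>T\<close>, so both error terms vanish.\<close>
  define d where "d = (1 - e) / 2"
  have d: "d > 0" "e = 1 - 2 * d" using e by (auto simp: d_def field_simps)
  have q0: "q > 0" using q by simp
  have S: "((\<lambda>T. S (N T)) \<longlongrightarrow> Re (zeta (of_real (2 * \<sigma>)))) at_top"
  proof -
    have "S \<longlonglongrightarrow> Re (zeta (of_real (2 * \<sigma>)))"
      using zeta_real_sums[of "2 * \<sigma>"] assms by (simp add: sums_def S_def)
    moreover have "filterlim N at_top at_top"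
    proof (rule filterlim_at_top_mono)
      show "filterlim (\<lambda>T. nat \<lfloor>T\<rfloor>) at_top at_top"
        by (intro filterlim_compose[OF filterlim_nat_sequentially filterlim_floor_sequentially])
      show "\<forall>\<^sub>F T in at_top. nat \<lfloor>T\<rfloor> \<le> N T"
        using eventually_ge_at_top[of 1]
      proof eventually_elim
        case (elim T)
        have "T powr 1 \<le> T powr q" using elim q by (intro powr_mono) auto
        then have "T \<le> T powr q" using elim by simp
        then show ?case unfolding N_def by (intro nat_mono) linarith
      qed
    qed
    ultimately show ?thesis by (rule filterlim_compose)
  qed
  have PT: "((\<lambda>T. P T / T) \<longlongrightarrow> Re (zeta (of_real (2 * \<sigma>)))) at_top"
  proof -
    have "((\<lambda>T. (P T - (T - 1) * S (N T)) / T) \<longlongrightarrow> 0) at_top"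
    proof (rule Lim_null_comparison)
      show "\<forall>\<^sub>F T in at_top. norm ((P T - (T - 1) * S (N T)) / T)
          \<le> 6 * (2 powr p * T powr e) * (1 + ln (2 * T powr q))\<^sup>2 / T"
        using eventually_ge_at_top[of 1]
        by eventually_elim (use P_le in \<open>auto intro: divide_right_mono\<close>)
      show "((\<lambda>T. 6 * (2 powr p * T powr e) * (1 + ln (2 * T powr q))\<^sup>2 / T) \<longlongrightarrow> 0) at_top"
        using e q0 by real_asymp
    qed
    moreover have "((\<lambda>T. (T - 1) / T * S (N T)) \<longlongrightarrow> 1 * Re (zeta (of_real (2 * \<sigma>)))) at_top"
      by (intro tendsto_mult S) real_asymp
    ultimately have "((\<lambda>T. (P T - (T - 1) * S (N T)) / T + (T - 1) / T * S (N T)) \<longlongrightarrow>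
       0 + 1 * Re (zeta (of_real (2 * \<sigma>)))) at_top" by (rule tendsto_add)
    moreover have "\<forall>\<^sub>F T in at_top. (P T - (T - 1) * S (N T)) / T + (T - 1) / T * S (N T) = P T / T"
      using eventually_gt_at_top[of 0] by eventually_elim (simp flip: add_divide_distrib)
    ultimately show ?thesis using tendsto_cong by fastforce
  qed
  have "((\<lambda>T. (I T - P T) / T) \<longlongrightarrow> 0) at_top"
  proof (rule Lim_null_comparison)
    define B where "B = 4 * C\<^sup>2 * 3 powr p"
    show "\<forall>\<^sub>F T in at_top. norm ((I T - P T) / T) \<le>
        T powr (- d) * (P T / T) + (1 + 1 / T powr (- d)) * (B * T powr e) / T"
      using eventually_ge_at_top[of 1]
    proof eventually_elim
      case (elim T)
      define \<delta> where "\<delta> = T powr (- d)"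
      have \<delta>: "\<delta> > 0" using elim by (simp add: \<delta>_def)
      have "\<bar>I T - P T\<bar> \<le> \<delta> * P T + (1 + 1 / \<delta>) * R T"
        using integral_norm_add_square[OF cont_D[of "{1..T}" "N T"] cont_tail[of T "N T"] \<delta>]
        by (simp add: I_def P_def R_def tail)
      also have "\<dots> \<le> \<delta> * P T + (1 + 1 / \<delta>) * (B * T powr e)"
        using R_le[OF elim] \<delta> unfolding B_def by (intro add_left_mono mult_left_mono) auto
      finally have "\<bar>I T - P T\<bar> / T \<le> (\<delta> * P T + (1 + 1 / \<delta>) * (B * T powr e)) / T"
        using elim by (intro divide_right_mono) auto
      then show ?case using elim unfolding \<delta>_def[symmetric] by (simp add: add_divide_distrib)
    qed
    have "((\<lambda>T. T powr (- d)) \<longlongrightarrow> 0) at_top" using d(1) by real_asymp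
    from tendsto_mult[OF this PT]
    have 1: "((\<lambda>T. T powr (- d) * (P T / T)) \<longlongrightarrow> 0) at_top" by simp
    have "((\<lambda>T. (1 + 1 / T powr (- d)) * T powr e / T) \<longlongrightarrow> 0) at_top"
      unfolding d(2) using d(1) by real_asymp
    from tendsto_mult_right[OF this, of B]
    have 2: "((\<lambda>T. (1 + 1 / T powr (- d)) * (B * T powr e) / T) \<longlongrightarrow> 0) at_top"
      by (simp add: mult_ac)
    from tendsto_add[OF 1 2]
    show "((\<lambda>T. T powr (- d) * (P T / T) + (1 + 1 / T powr (- d)) * (B * T powr e) / T) \<longlongrightarrow> 0) at_top"
      by simp
  qed
  from tendsto_add[OF this PT] show ?thesis by (simp add: I_def diff_divide_distrib)
qed

section \<open>Evaluation of the limit and the equivalence\<close>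

lemma tendsto_of_smallo_linear:
  fixes f :: "real \<Rightarrow> real"
  assumes "(\<lambda>T. f T - c * T) \<in> o(\<lambda>T. T)"
  shows "((\<lambda>T. f T / T) \<longlongrightarrow> c) at_top"
proof -
  have "((\<lambda>T. (f T - c * T) / T + c) \<longlongrightarrow> 0 + c) at_top"
    by (intro tendsto_add smalloD_tendsto[OF assms] tendsto_const)
  moreover have "\<forall>\<^sub>F T in at_top. (f T - c * T) / T + c = f T / T"
    using eventually_gt_at_top[of 0] by eventually_elim (simp add: field_simps)
  ultimately show ?thesis using filterlim_cong by fastforce
qed

text \<open>\<open>x >= 1\<close> and \<open>z >= 1\<close> make the ratio positive, so
  \<open>T\<close> tends to infinity with \<open>\<tau>\<close> and the three asymptotics in
  \<open>T\<close> apply.\<close>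

lemma fermat_L_eq_ratio:
  assumes "\<sigma> > 1 / 2" and selberg: "selberg_constant l cbar" and ladder: "jacobs_ladder t0 \<phi>"
    and "x \<ge> 1" and "z \<ge> 1"
  shows "fermat_L t0 \<phi> \<sigma> l cbar x y z n = fermat_ratio x y z n"
proof -
  define r A where "r = fermat_ratio x y z n" and "A = scale_A \<sigma> l cbar"
  have r: "r > 0" unfolding r_def fermat_ratio_def using assms by (simp add: add_pos_nonneg)
  define I1 where "I1 = (\<lambda>T. integral {T..ladder_inv t0 \<phi> T} (\<lambda>t. (cmod (zeta (Complex (1/2) t)))\<^sup>2))"
  define I2 where "I2 = (\<lambda>T. integral {1..T} (\<lambda>t. (cmod (zeta (Complex \<sigma> t)))\<^sup>2))"
  define I3 where "I3 = (\<lambda>T. integral {1..T} (\<lambda>t. \<bar>zeta_S1 t\<bar> ^ (2 * l)))"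
  have A: "A > 0"
    unfolding A_def scale_A_def
    using euler_mascheroni_less_13_over_22 zeta_real_pos[of "2 * \<sigma>"] assms
    by (auto intro!: mult_pos_pos simp: selberg_constant_def)
  have 1: "((\<lambda>T. I1 T / T) \<longlongrightarrow> 1 - euler_mascheroni) at_top"
  proof (rule tendsto_of_smallo_linear)
    \<comment> \<open>Any positive \<open>\<delta> < 2/3\<close> makes the ladder error
      \<open>o(T)\<close>; here \<open>\<delta> = 1/3\<close>.\<close>
    have "(\<lambda>T. I1 T - (1 - euler_mascheroni) * T) \<in> O(\<lambda>T. T powr (1/3 + 1/3))"
      using ladder unfolding jacobs_ladder_def I1_def by (auto dest!: spec[of _ "1/3"])
    moreover have "(\<lambda>T::real. T powr (1/3 + 1/3)) \<in> o(\<lambda>T. T)" by real_asymp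
    ultimately show "(\<lambda>T. I1 T - (1 - euler_mascheroni) * T) \<in> o(\<lambda>T. T)"
      by (rule landau_o.big_small_trans)
  qed
  have 2: "((\<lambda>T. I2 T / T) \<longlongrightarrow> Re (zeta (of_real (2 * \<sigma>)))) at_top"
    unfolding I2_def by (rule zeta_mean_square[OF assms(1)])
  have 3: "((\<lambda>T. I3 T / T) \<longlongrightarrow> cbar) at_top"
  proof (rule tendsto_of_smallo_linear)
    have "(\<lambda>T. I3 T - cbar * T) \<in> O(\<lambda>T. T / ln T)"
      using selberg unfolding selberg_constant_def I3_def by auto
    moreover have "(\<lambda>T::real. T / ln T) \<in> o(\<lambda>T. T)" by real_asymp
    ultimately show "(\<lambda>T. I3 T - cbar * T) \<in> o(\<lambda>T. T)"
      by (rule landau_o.big_small_trans)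
  qed
  have "((\<lambda>T. root 3 (I1 T / T * (I2 T / T) * (I3 T / T))) \<longlongrightarrow>
      root 3 ((1 - euler_mascheroni) * Re (zeta (of_real (2 * \<sigma>))) * cbar)) at_top"
    by (intro tendsto_intros 1 2 3)
  also have "root 3 ((1 - euler_mascheroni) * Re (zeta (of_real (2 * \<sigma>))) * cbar) = A"
    by (simp add: A_def scale_A_def mult_ac)
  finally have lim: "((\<lambda>T. root 3 (I1 T / T * (I2 T / T) * (I3 T / T))) \<longlongrightarrow> A) at_top" .
  have T: "filterlim (\<lambda>\<tau>. r * \<tau> / A) at_top at_top" using r A by real_asymp
  from tendsto_mult_left[OF filterlim_compose[OF lim T], of "r / A"]
  have "((\<lambda>\<tau>. r / A * root 3 (I1 (r * \<tau> / A) / (r * \<tau> / A) * (I2 (r * \<tau> / A) / (r * \<tau> / A)) *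
       (I3 (r * \<tau> / A) / (r * \<tau> / A)))) \<longlongrightarrow> r) at_top"
    using A by simp
  \<comment> \<open>With \<open>T = r * \<tau> / A\<close>, the prefactor \<open>r / A\<close> is
    \<open>T / \<tau>\<close>, and the three divisions by \<open>T\<close> leave the cube root as a
    single one.\<close>
  moreover have "\<forall>\<^sub>F \<tau> in at_top. r / A * root 3 (I1 (r * \<tau> / A) / (r * \<tau> / A) * (I2 (r * \<tau> / A) / (r * \<tau> / A)) *
       (I3 (r * \<tau> / A) / (r * \<tau> / A))) =
     1 / \<tau> * root 3 (I1 (r * \<tau> / A) * I2 (r * \<tau> / A) * I3 (r * \<tau> / A))"
    using eventually_gt_at_top[of 0]
  proof eventually_elim
    case (elim \<tau>)
    define T where "T = r * \<tau> / A"
    have T: "T > 0" using r A elim by (simp add: T_def)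
    have "root 3 (T ^ 3) = T" using T by (intro real_root_power_cancel) auto
    moreover have "I1 T / T * (I2 T / T) * (I3 T / T) = I1 T * I2 T * I3 T / T ^ 3"
      by (simp add: power3_eq_cube)
    ultimately have "root 3 (I1 T / T * (I2 T / T) * (I3 T / T)) = root 3 (I1 T * I2 T * I3 T) / T"
      by (simp only: real_root_divide)
    moreover have "r / A = T / \<tau>" using elim by (simp add: T_def)
    ultimately show ?case using T by (simp flip: T_def)
  qed
  ultimately have "((\<lambda>\<tau>. 1 / \<tau> * root 3 (I1 (r * \<tau> / A) * I2 (r * \<tau> / A) * I3 (r * \<tau> / A))) \<longlongrightarrow> r) at_top"
    by (rule Lim_transform_eventually)
  \<comment> \<open>\<open>Lim\<close> is a definite description, so its value can be read off only
    once convergence is known.\<close>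
  then show ?thesis
    unfolding fermat_L_def Let_def r_def[symmetric] A_def[symmetric]
    by (intro tendsto_Lim) (simp_all add: I1_def I2_def I3_def)
qed

theorem theorem1:
  fixes \<epsilon> \<sigma> cbar t0 :: real and l :: nat and \<phi> :: "real \<Rightarrow> real"
  assumes "\<epsilon> > 0" and "\<sigma> \<ge> 1/2 + \<epsilon>" and "l \<ge> 1"
    and "selberg_constant l cbar"
    and "jacobs_ladder t0 \<phi>"
  shows "(\<not> (\<exists>(x::nat) (y::nat) (z::nat) (n::nat). x \<ge> 1 \<and> y \<ge> 1 \<and> z \<ge> 1 \<and> n \<ge> 3 \<and> x ^ n + y ^ n = z ^ n)) \<longleftrightarrow>
         (\<forall>(x::nat) (y::nat) (z::nat) (n::nat). x \<ge> 1 \<and> y \<ge> 1 \<and> z \<ge> 1 \<and> n \<ge> 3 \<longrightarrow>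
            fermat_L t0 \<phi> \<sigma> l cbar x y z n \<noteq> 1)"
proof -
  \<comment> \<open>The limit is the ratio and \<open>z ^ n\<close> is nonzero, so the equivalence
    holds quadruple by quadruple, without deciding either side.\<close>
  have "fermat_L t0 \<phi> \<sigma> l cbar x y z n = 1 \<longleftrightarrow> x ^ n + y ^ n = z ^ n"
    if "x \<ge> 1" "z \<ge> 1" for x y z n :: nat
  proof -
    have "fermat_L t0 \<phi> \<sigma> l cbar x y z n = real (x ^ n + y ^ n) / real (z ^ n)"
      using fermat_L_eq_ratio[OF _ assms(4,5) that, of \<sigma> y n] assms(1,2)
      by (simp add: fermat_ratio_def)
    moreover have "real (z ^ n) \<noteq> 0" using that by simp
    ultimately show ?thesis by (simp only: divide_eq_1_iff of_nat_eq_iff simp_thms)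
  qed
  then show ?thesis by blast
qed

end
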